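(* Let $d$ be a positive square-free integer, $M=\mathbb{Q}(i\sqrt{d})$ with ring of integers $\mathbb{Z}_M$, let $a\in\mathbb{Z}$, let $\alpha$ be a root of $f(x)=x^3-ax^2-(a+3)x-1$, and let $\mathcal{O}$ be the order of $K=M(\alpha)$ with $\mathbb{Z}$-basis $\{1,\alpha,\alpha^2,\omega,\omega\alpha,\omega\alpha^2\}$ (with $\omega$ as in the context). Then, up to equivalence over $M$, all generators of relative power integral bases of $\mathcal{O}$ over $M$ are of the form $$X_1\alpha+X_2\alpha^2,\qquad X_1=Y_1-aY_2,\quad X_2=Y_2,$$ where $(Y_1,Y_2)\in\mathbb{Z}_M^2$ is a solution of the relative Thue equation $$Y_1^3-aY_1^2Y_2-(a+3)Y_1Y_2^2-Y_2^3=\varepsilon \qquad (Y_1,Y_2\in\mathbb{Z}_M)$$ for some unit $\varepsilon$ of $\mathbb{Z}_M$.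
   Context: Let $d$ be a positive square-free integer and $M=\mathbb{Q}(i\sqrt{d})$, with ring of integers $\mathbb{Z}_M$. Set $\omega=i\sqrt{d}$ if $-d\equiv 2,3\pmod 4$, and $\omega=(1+i\sqrt{d})/2$ if $-d\equiv 1\pmod 4$. For a parameter $a\in\mathbb{Z}$ let $f(x)=x^3-ax^2-(a+3)x-1$, let $\alpha$ be a root of $f$, and let $K=M(\alpha)$, a sextic field. Let $\mathcal{O}$ be the order of $K$ with $\mathbb{Z}$-basis $\{1,\alpha,\alpha^2,\omega,\omega\alpha,\omega\alpha^2\}$, i.e. $\mathcal{O}=\mathbb{Z}_M[\alpha]$. An element $\vartheta\in\mathcal{O}$ generates a relative power integral basis $(1,\vartheta,\vartheta^2)$ of $\mathcal{O}$ over $M$ if $\mathcal{O}=\mathbb{Z}_M[\vartheta]$. Two elements $\beta,\gamma\in\mathcal{O}$ are called equivalent (over $M$) if $\beta=b+\eta\gamma$ with some $b\in\mathbb{Z}_M$ and some unit $\eta\in\mathbb{Z}_M$; if $\beta$ and $\gamma$ are equivalent, then $\beta$ generates a relative power integral basis if and only if $\gamma$ does, and generators are considered up to equivalence. *)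

theory Defs
  imports
    Complex_Main
    "HOL-Computational_Algebra.Polynomial"
    "HOL-Computational_Algebra.Squarefree"
begin

text \<open>
  All number fields are taken inside the complex numbers. Subfields, unit groups and
  ring adjunctions are therefore sets of complex numbers.
\<close>

definition subfield_set :: "'a::field set \<Rightarrow> bool" where
  "subfield_set F \<longleftrightarrow> 0 \<in> F \<and> 1 \<in> F \<and>
     (\<forall>x\<in>F. \<forall>y\<in>F. x + y \<in> F \<and> x * y \<in> F) \<and> (\<forall>x\<in>F. - x \<in> F \<and> inverse x \<in> F)"

definition field_adjoin :: "'a::field set \<Rightarrow> 'a \<Rightarrow> 'a set" where
  "field_adjoin F x = \<Inter>{L. subfield_set L \<and> F \<subseteq> L \<and> x \<in> L}"

definition ring_adjoin :: "'a::comm_ring_1 set \<Rightarrow> 'a \<Rightarrow> 'a set" where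
  "ring_adjoin R x = {poly p x |p. \<forall>i. coeff p i \<in> R}"

definition units_in :: "'a::comm_ring_1 set \<Rightarrow> 'a set" where
  "units_in R = {u \<in> R. \<exists>v\<in>R. u * v = 1}"

definition ring_of_integers :: "'a::field_char_0 set \<Rightarrow> 'a set" where
  "ring_of_integers F = {x \<in> F. algebraic_int x}"

definition imag_sqrt :: "int \<Rightarrow> complex" where
  "imag_sqrt d = \<i> * complex_of_real (sqrt (of_int d))"

definition imag_quad_field :: "int \<Rightarrow> complex set" where
  "imag_quad_field d = field_adjoin \<rat> (imag_sqrt d)"

abbreviation imag_quad_ints :: "int \<Rightarrow> complex set" where
  "imag_quad_ints d \<equiv> ring_of_integers (imag_quad_field d)"

text \<open>
  For square-free \<open>d\<close> the residue of \<open>- d\<close> modulo 4 (which \<open>mod\<close> takes in \<open>{0..3}\<close>)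
  is never 0, so the second branch is exactly the case of residue 2 or 3.
\<close>

definition quad_omega :: "int \<Rightarrow> complex" where
  "quad_omega d = (if (- d) mod 4 = 1 then (1 + imag_sqrt d) / 2 else imag_sqrt d)"

definition simplest_cubic :: "int \<Rightarrow> complex poly" where
  "simplest_cubic a = [:- 1, - (of_int a + 3), - of_int a, 1:]"

definition sextic_field :: "int \<Rightarrow> complex \<Rightarrow> complex set" where
  "sextic_field d \<alpha> = field_adjoin (imag_quad_field d) \<alpha>"

text \<open>
  The \<open>\<int>\<close>-span of the six listed elements. When \<open>\<alpha>\<close> is a root of \<^term>\<open>simplest_cubic a\<close>
  they are linearly independent, since that polynomial has no rational root and hence, its degree
  being 3, stays irreducible over the quadratic field.
\<close>

definition sextic_order :: "int \<Rightarrow> complex \<Rightarrow> complex set" where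
  "sextic_order d \<alpha> =
     {of_int x0 + of_int x1 * \<alpha> + of_int x2 * \<alpha>^2 + of_int y0 * quad_omega d
        + of_int y1 * (quad_omega d * \<alpha>) + of_int y2 * (quad_omega d * \<alpha>^2)
      |x0 x1 x2 y0 y1 y2. True}"

definition generates_rel_pib :: "int \<Rightarrow> complex \<Rightarrow> complex \<Rightarrow> bool" where
  "generates_rel_pib d \<alpha> \<theta> \<longleftrightarrow>
     \<theta> \<in> sextic_order d \<alpha> \<and> sextic_order d \<alpha> = ring_adjoin (imag_quad_ints d) \<theta>"

definition rel_equivalent :: "int \<Rightarrow> complex \<Rightarrow> complex \<Rightarrow> complex \<Rightarrow> bool" where
  "rel_equivalent d \<alpha> \<beta> \<gamma> \<longleftrightarrow>
     \<beta> \<in> sextic_order d \<alpha> \<and> \<gamma> \<in> sextic_order d \<alpha> \<and>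
     (\<exists>b\<in>imag_quad_ints d. \<exists>\<eta>\<in>units_in (imag_quad_ints d). \<beta> = b + \<eta> * \<gamma>)"

lemma of_int_mem_subfield_set:
  fixes L :: "complex set"
  assumes L: "subfield_set L" shows "of_int n \<in> L"
proof -
  have nat: "of_nat k \<in> L" for k
    using L by (induction k) (auto simp: subfield_set_def)
  show ?thesis
  proof (cases n rule: int_cases2)
    case (nonneg k)
    then show ?thesis using nat[of k] by simp
  next
    case (nonpos k)
    then show ?thesis using nat[of k] L by (simp add: subfield_set_def)
  qed
qed

lemma sextic_order_subset_field: "sextic_order d \<alpha> \<subseteq> sextic_field d \<alpha>"
proof -
  have "sextic_order d \<alpha> \<subseteq> L"
    if L: "subfield_set L" and sub: "imag_quad_field d \<subseteq> L" and "\<alpha> \<in> L" for L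
  proof -
    have add: "x + y \<in> L" and mul: "x * y \<in> L" if "x \<in> L" "y \<in> L" for x y
      using L that by (auto simp: subfield_set_def)
    have int: "of_int n \<in> L" for n
      using L by (rule of_int_mem_subfield_set)
    have s: "imag_sqrt d \<in> L"
    proof (rule subsetD[OF sub])
      show "imag_sqrt d \<in> imag_quad_field d"
        unfolding imag_quad_field_def field_adjoin_def by simp
    qed
    have half: "inverse (of_int 2) \<in> L"
      using L int[of 2] by (simp only: subfield_set_def Ball_def)
    have "of_int 1 + imag_sqrt d \<in> L"
      by (rule add[OF int s])
    from mul[OF this half] have "(1 + imag_sqrt d) / 2 \<in> L"
      by (simp only: divide_inverse of_int_1 of_int_numeral)
    with s have w: "quad_omega d \<in> L"
      by (simp add: quad_omega_def)
    show ?thesis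
    proof
      fix x assume "x \<in> sextic_order d \<alpha>"
      then obtain x0 x1 x2 y0 y1 y2 where
        x: "x = of_int x0 + of_int x1 * \<alpha> + of_int x2 * \<alpha>^2 + of_int y0 * quad_omega d
              + of_int y1 * (quad_omega d * \<alpha>) + of_int y2 * (quad_omega d * \<alpha>^2)"
        unfolding sextic_order_def by blast
      show "x \<in> L"
        unfolding x power2_eq_square by (intro add mul int w \<open>\<alpha> \<in> L\<close>)
    qed
  qed
  then show ?thesis
    unfolding sextic_field_def field_adjoin_def[of "imag_quad_field d"]
    by (intro Inter_greatest) simp
qed

end

theory Submission
  imports Defs
begin

text \<open>
  The theorem says that the relative index of an element of \<open>\<int>\<^sub>M[\<alpha>]\<close>, as a form in its coordinates,
  is the homogenised defining polynomial of \<open>\<alpha>\<close>. Write \<open>\<theta> = c + X1 \<alpha> + X2 \<alpha>^2\<close> and let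
  \<open>\<alpha>\<close>, \<open>\<alpha>'\<close>, \<open>\<alpha>''\<close> be the roots of \<open>f\<close>, whose sum is \<open>a\<close>. For two conjugates,
  \<open>(\<theta> - \<theta>') / (\<alpha> - \<alpha>') = X1 + X2 (\<alpha> + \<alpha>') = X1 + X2 (a - \<alpha>'') = Y1 - \<alpha>'' Y2\<close>
  with \<open>Y1 = X1 + a X2\<close> and \<open>Y2 = X2\<close>. The product of these three quotients is the
  determinant of the passage from \<open>1, \<alpha>, \<alpha>^2\<close> to \<open>1, \<theta>, \<theta>^2\<close>, and it equals
  the homogenised \<open>f\<close> at \<open>(Y1, Y2)\<close>, the left side of the Thue equation. So \<open>\<theta>\<close> generates the order if and only
  if this value is a unit. Since \<open>\<int>\<^sub>M[\<theta>] = \<int>\<^sub>M[b + \<eta> \<theta>]\<close> for units \<open>\<eta>\<close>, generators are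
  only determined up to equivalence; subtracting \<open>c\<close> gives the representative in the theorem.

  The formal argument avoids conjugates. Over any commutative ring in which \<open>1, \<alpha>, \<alpha>^2\<close> are
  independent and span \<open>R[\<alpha>]\<close>, the coordinates of \<open>\<beta>\<close> and \<open>\<beta>^2\<close> for
  \<open>\<beta> = X1 \<alpha> + X2 \<alpha>^2\<close> form a 2 by 2 matrix, whose determinant is computed to be that form
  (\<open>cubic_form_det\<close>); an explicit cubic equation for \<open>\<beta>\<close> (\<open>cubic_equation\<close>) shows that
  \<open>R[\<beta>]\<close> is spanned by \<open>1, \<beta>, \<beta>^2\<close>, so that \<open>R[\<beta>] = R[\<alpha>]\<close> amounts to invertibility
  of the matrix (\<open>generates_iff_index_unit\<close>).

  Two arithmetic facts make this applicable. The integers of \<open>M\<close> are \<open>\<int> + \<int>\<omega>\<close>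
  (\<open>imag_quad_ints_eq\<close>, resting on Gauss's lemma for content), so the \<open>\<int>\<close>-span of the six
  basis elements is the \<open>\<int>\<^sub>M\<close>-span of \<open>1, \<alpha>, \<alpha>^2\<close>. And \<open>f\<close> has no root in \<open>M\<close>
  (\<open>simplest_cubic_no_root\<close>): such a root would be an integer of degree at most two, hence \<open>f\<close>
  would have a rational integer root, while \<open>f\<close> takes only odd values on \<open>\<int>\<close>.
\<close>

section \<open>Adjoining an element to a ring\<close>

definition subring_set :: "'a::comm_ring_1 set \<Rightarrow> bool" where
  "subring_set R \<longleftrightarrow> 1 \<in> R \<and> (\<forall>x\<in>R. \<forall>y\<in>R. x + y \<in> R \<and> x * y \<in> R) \<and> (\<forall>x\<in>R. - x \<in> R)"

lemma subring_setD:
  assumes "subring_set R"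
  shows subring_set_0: "0 \<in> R" and subring_set_1: "1 \<in> R"
    and subring_set_add: "x \<in> R \<Longrightarrow> y \<in> R \<Longrightarrow> x + y \<in> R"
    and subring_set_mult: "x \<in> R \<Longrightarrow> y \<in> R \<Longrightarrow> x * y \<in> R"
    and subring_set_uminus: "x \<in> R \<Longrightarrow> - x \<in> R"
    and subring_set_diff: "x \<in> R \<Longrightarrow> y \<in> R \<Longrightarrow> x - y \<in> R"
    and subring_set_power: "x \<in> R \<Longrightarrow> x ^ n \<in> R"
    and subring_set_numeral: "numeral k \<in> R"
proof -
  have minus: "- x \<in> R" if "x \<in> R" for x using assms that by (simp add: subring_set_def)
  have add: "x + y \<in> R" if "x \<in> R" "y \<in> R" for x y
    using assms that by (simp add: subring_set_def)
  show one: "1 \<in> R" using assms by (simp add: subring_set_def)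
  show zero: "0 \<in> R" using add[OF one minus[OF one]] by simp
  show "x + y \<in> R" if "x \<in> R" "y \<in> R" by (rule add[OF that])
  show mult: "x * y \<in> R" if "x \<in> R" "y \<in> R" for x y
    using assms that by (simp add: subring_set_def)
  show "- x \<in> R" if "x \<in> R" by (rule minus[OF that])
  show "x - y \<in> R" if "x \<in> R" "y \<in> R" using add[OF that(1) minus[OF that(2)]] by simp
  show "x ^ n \<in> R" if "x \<in> R" by (induction n) (auto intro: one mult that)
  have "of_nat n \<in> R" for n by (induction n) (auto intro: zero one add)
  from this[of "numeral k"] show "numeral k \<in> R" by simp
qed

lemmas subring_set_closed =
  subring_set_0 subring_set_1 subring_set_add subring_set_mult subring_set_uminus
  subring_set_diff subring_set_power subring_set_numeral

lemma subring_set_ring_adjoin: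
  assumes R: "subring_set R"
  shows "subring_set (ring_adjoin R x)"
  unfolding subring_set_def
proof (intro conjI ballI)
  show "1 \<in> ring_adjoin R x"
    unfolding ring_adjoin_def using R
    by (intro CollectI exI[of _ 1]) (auto simp: coeff_1 intro: subring_set_closed)
next
  fix y assume "y \<in> ring_adjoin R x"
  then obtain p where p: "y = poly p x" "\<forall>i. coeff p i \<in> R" unfolding ring_adjoin_def by blast
  show "- y \<in> ring_adjoin R x"
    unfolding ring_adjoin_def using p R
    by (intro CollectI exI[of _ "- p"]) (auto intro: subring_set_closed)
  fix z assume "z \<in> ring_adjoin R x"
  then obtain q where q: "z = poly q x" "\<forall>i. coeff q i \<in> R" unfolding ring_adjoin_def by blast
  show "y + z \<in> ring_adjoin R x"
    unfolding ring_adjoin_def using p q R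
    by (intro CollectI exI[of _ "p + q"]) (auto intro: subring_set_closed)
  have sum_in_R: "sum g A \<in> R" if "\<And>i. g i \<in> R" for g :: "nat \<Rightarrow> 'a" and A
    using that R by (induction A rule: infinite_finite_induct) (auto intro: subring_set_closed)
  show "y * z \<in> ring_adjoin R x"
    unfolding ring_adjoin_def using p q R
    by (intro CollectI exI[of _ "p * q"]) (auto simp: coeff_mult intro!: sum_in_R subring_set_mult)
qed

lemma ring_adjoin_base:
  assumes "subring_set R" and "c \<in> R"
  shows "c \<in> ring_adjoin R x"
  unfolding ring_adjoin_def using assms
  by (intro CollectI exI[of _ "[:c:]"]) (auto simp: coeff_pCons split: nat.split intro: subring_set_closed)

lemma ring_adjoin_self:
  assumes "subring_set R"
  shows "x \<in> ring_adjoin R x"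
  unfolding ring_adjoin_def using assms
  by (intro CollectI exI[of _ "[:0, 1:]"]) (auto simp: coeff_pCons split: nat.split intro: subring_set_closed)

lemma poly_in_subring_set:
  assumes S: "subring_set S" and "x \<in> S" and "\<forall>i. coeff p i \<in> S"
  shows "poly p x \<in> S"
  using assms(3)
proof (induction p)
  case 0
  then show ?case using S by (simp add: subring_set_0)
next
  case (pCons a p)
  have "a \<in> S" using pCons.prems[rule_format, of 0] by simp
  moreover have "\<forall>i. coeff p i \<in> S"
    using pCons.prems by (metis coeff_pCons_Suc)
  ultimately show ?case using pCons.IH S assms(2) by (simp add: subring_set_closed)
qed

lemma ring_adjoin_subset:
  assumes "subring_set R" and "y \<in> ring_adjoin R x"
  shows "ring_adjoin R y \<subseteq> ring_adjoin R x"
proof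
  fix z assume "z \<in> ring_adjoin R y"
  then obtain p where "z = poly p y" "\<forall>i. coeff p i \<in> R" unfolding ring_adjoin_def by blast
  then show "z \<in> ring_adjoin R x"
    using poly_in_subring_set[OF subring_set_ring_adjoin[OF assms(1)] assms(2)]
      ring_adjoin_base[OF assms(1)] by blast
qed

text \<open>
  Each of \<open>b + u x\<close> and \<open>x\<close> is a polynomial of degree one in the other. This is the invariance of
  generators under equivalence.
\<close>

lemma ring_adjoin_affine:
  assumes R: "subring_set R" and b: "b \<in> R" and u: "u \<in> units_in R"
  shows "ring_adjoin R (b + u * x) = ring_adjoin R x"
proof
  note S = subring_set_ring_adjoin[OF R]
  obtain v where v: "u \<in> R" "v \<in> R" "u * v = 1" using u unfolding units_in_def by blast
  have "b + u * x \<in> ring_adjoin R x"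
    by (intro subring_set_add[OF S] subring_set_mult[OF S] ring_adjoin_base[OF R]
        ring_adjoin_self[OF R] b v)
  then show "ring_adjoin R (b + u * x) \<subseteq> ring_adjoin R x" by (rule ring_adjoin_subset[OF R])
  have "v * (b + u * x - b) = (u * v) * x" by (simp add: algebra_simps)
  then have "x = v * (b + u * x - b)" by (simp add: v)
  moreover have "v * (b + u * x - b) \<in> ring_adjoin R (b + u * x)"
    by (intro subring_set_diff[OF S] subring_set_mult[OF S] ring_adjoin_base[OF R]
        ring_adjoin_self[OF R] b v)
  ultimately show "ring_adjoin R x \<subseteq> ring_adjoin R (b + u * x)"
    by (intro ring_adjoin_subset[OF R]) simp
qed

definition quad_span :: "'a::comm_ring_1 set \<Rightarrow> 'a \<Rightarrow> 'a set" where
  "quad_span R x = {u0 + u1 * x + u2 * x^2 |u0 u1 u2. u0 \<in> R \<and> u1 \<in> R \<and> u2 \<in> R}"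

text \<open>
  Multiplication by \<open>x\<close> maps the span into itself, as the cubic equation rewrites \<open>x^3\<close>; Horner's
  scheme then keeps the value of every polynomial at \<open>x\<close> in the span.
\<close>

lemma ring_adjoin_cubic:
  assumes R: "subring_set R" and "P \<in> R" "Q \<in> R" "N \<in> R"
    and cubic: "x^3 = P * x^2 + Q * x + N"
  shows "ring_adjoin R x = quad_span R x"
proof
  note closed = subring_set_closed[OF R]
  show "quad_span R x \<subseteq> ring_adjoin R x"
  proof
    fix y assume "y \<in> quad_span R x"
    then obtain u0 u1 u2 where "u0 \<in> R" "u1 \<in> R" "u2 \<in> R" "y = u0 + u1 * x + u2 * x^2"
      unfolding quad_span_def by blast
    then show "y \<in> ring_adjoin R x"
      using subring_set_closed[OF subring_set_ring_adjoin[OF R, of x]]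
        ring_adjoin_base[OF R] ring_adjoin_self[OF R] by simp
  qed
  have "poly p x \<in> quad_span R x" if "\<forall>i. coeff p i \<in> R" for p
    using that
  proof (induction p)
    case 0
    have "(0::'a) = 0 + 0 * x + 0 * x^2" by simp
    then show ?case unfolding quad_span_def poly_0 using closed(1) by blast
  next
    case (pCons a p)
    have a: "a \<in> R" using pCons.prems[rule_format, of 0] by simp
    have "\<forall>i. coeff p i \<in> R" using pCons.prems by (metis coeff_pCons_Suc)
    then obtain u0 u1 u2 where u: "u0 \<in> R" "u1 \<in> R" "u2 \<in> R" "poly p x = u0 + u1 * x + u2 * x^2"
      using pCons.IH unfolding quad_span_def by blast
    have "x * (u0 + u1 * x + u2 * x^2) = u0 * x + u1 * x^2 + u2 * x^3"
      by (simp add: algebra_simps power2_eq_square power3_eq_cube)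
    also have "\<dots> = u2 * N + (u0 + u2 * Q) * x + (u1 + u2 * P) * x^2"
      unfolding cubic by (simp add: algebra_simps)
    finally have "poly (pCons a p) x = (a + u2 * N) + (u0 + u2 * Q) * x + (u1 + u2 * P) * x^2"
      by (simp add: u)
    then show ?case unfolding quad_span_def using u a assms(2-4)
      by (intro CollectI exI[of _ "a + u2 * N"] exI[of _ "u0 + u2 * Q"] exI[of _ "u1 + u2 * P"])
        (simp add: closed)
  qed
  then show "ring_adjoin R x \<subseteq> quad_span R x" unfolding ring_adjoin_def by blast
qed

section \<open>The index form of a cubic order\<close>

locale cubic_order =
  fixes R :: "'a::comm_ring_1 set" and \<alpha> p q r :: 'a
  assumes R: "subring_set R" and coeffs: "p \<in> R" "q \<in> R" "r \<in> R"
    and cubic: "\<alpha>^3 = p * \<alpha>^2 + q * \<alpha> + r"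
    and independent: "\<And>u0 u1 u2. \<lbrakk>u0 \<in> R; u1 \<in> R; u2 \<in> R; u0 + u1 * \<alpha> + u2 * \<alpha>^2 = 0\<rbrakk>
      \<Longrightarrow> u0 = 0 \<and> u1 = 0 \<and> u2 = 0"
begin

lemmas closed = subring_set_closed[OF R]

lemma ring_adjoin_eq_quad_span: "ring_adjoin R \<alpha> = quad_span R \<alpha>"
  using R coeffs cubic by (rule ring_adjoin_cubic)

lemma independent_eq:
  assumes "u0 \<in> R" "u1 \<in> R" "u2 \<in> R" "v0 \<in> R" "v1 \<in> R" "v2 \<in> R"
    and "u0 + u1 * \<alpha> + u2 * \<alpha>^2 = v0 + v1 * \<alpha> + v2 * \<alpha>^2"
  shows "u0 = v0 \<and> u1 = v1 \<and> u2 = v2"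
proof -
  have "(u0 - v0) + (u1 - v1) * \<alpha> + (u2 - v2) * \<alpha>^2 = 0"
    using assms(7) by (simp add: algebra_simps)
  from independent[OF closed(6) closed(6) closed(6) this] assms show ?thesis by simp
qed

lemma cubic_pow4: "\<alpha>^4 = (p^2 + q) * \<alpha>^2 + (p * q + r) * \<alpha> + p * r"
proof -
  have "\<alpha>^4 = \<alpha> * \<alpha>^3" by (simp add: eval_nat_numeral)
  also have "\<dots> = \<alpha> * (p * \<alpha>^2 + q * \<alpha> + r)" by (simp only: cubic)
  also have "\<dots> = p * \<alpha>^3 + q * \<alpha>^2 + r * \<alpha>"
    by (simp add: algebra_simps eval_nat_numeral)
  also have "\<dots> = (p^2 + q) * \<alpha>^2 + (p * q + r) * \<alpha> + p * r"
    unfolding cubic by (simp add: algebra_simps eval_nat_numeral)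
  finally show ?thesis .
qed

lemma square_coords:
  "(x * \<alpha> + y * \<alpha>^2)^2 =
     (2 * r * x * y + p * r * y^2) + (2 * q * x * y + (p * q + r) * y^2) * \<alpha>
     + (x^2 + 2 * p * x * y + (p^2 + q) * y^2) * \<alpha>^2"
proof -
  have "(x * \<alpha> + y * \<alpha>^2)^2 = x^2 * \<alpha>^2 + 2 * x * y * \<alpha>^3 + y^2 * \<alpha>^4"
    by (simp add: algebra_simps eval_nat_numeral)
  also have "\<dots> = (2 * r * x * y + p * r * y^2) + (2 * q * x * y + (p * q + r) * y^2) * \<alpha>
     + (x^2 + 2 * p * x * y + (p^2 + q) * y^2) * \<alpha>^2"
    unfolding cubic cubic_pow4 by (simp add: algebra_simps)
  finally show ?thesis .
qed

text \<open>
  The Cayley-Hamilton equation of multiplication by \<open>x \<alpha> + y \<alpha>^2\<close> on \<open>R[\<alpha>]\<close>: the coefficients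
  are the trace, the negated sum of the principal 2 by 2 minors, and the determinant of the matrix
  of that map with respect to \<open>1, \<alpha>, \<alpha>^2\<close>. They lie
  in \<open>R\<close>, so \<open>R[x \<alpha> + y \<alpha>^2]\<close> is spanned by three powers.
\<close>

lemma cubic_equation:
  defines "\<beta> \<equiv> \<lambda>x y. x * \<alpha> + y * \<alpha>^2"
  shows "(\<beta> x y)^3 = (p * x + (p^2 + 2 * q) * y) * (\<beta> x y)^2
    + (q * x^2 + (p * q + 3 * r) * x * y + (2 * p * r - q^2) * y^2) * \<beta> x y
    + (r * x^3 + p * r * x^2 * y - q * r * x * y^2 + r^2 * y^3)"
proof -
  have "(\<beta> x y)^3 = (x * \<alpha> + y * \<alpha>^2) * (\<beta> x y)^2"
    by (simp add: \<beta>_def power3_eq_cube power2_eq_square)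
  also have "\<dots> = (2 * r * x * y + p * r * y^2) * (x * \<alpha> + y * \<alpha>^2)
      + (2 * q * x * y + (p * q + r) * y^2) * (x * \<alpha>^2 + y * \<alpha>^3)
      + (x^2 + 2 * p * x * y + (p^2 + q) * y^2) * (x * \<alpha>^3 + y * \<alpha>^4)"
    unfolding \<beta>_def square_coords by (simp add: algebra_simps eval_nat_numeral)
  also have "\<dots> = (p * x + (p^2 + 2 * q) * y) * (\<beta> x y)^2
    + (q * x^2 + (p * q + 3 * r) * x * y + (2 * p * r - q^2) * y^2) * \<beta> x y
    + (r * x^3 + p * r * x^2 * y - q * r * x * y^2 + r^2 * y^3)"
    unfolding cubic cubic_pow4 \<beta>_def square_coords
    by (simp add: algebra_simps power2_eq_square power3_eq_cube)
  finally show ?thesis .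
qed

lemma ring_adjoin_eq_quad_span_no_const:
  assumes "x \<in> R" "y \<in> R"
  shows "ring_adjoin R (x * \<alpha> + y * \<alpha>^2) = quad_span R (x * \<alpha> + y * \<alpha>^2)"
  by (rule ring_adjoin_cubic[OF R _ _ _ cubic_equation]; intro closed assms coeffs)

text \<open>
  The homogenisation of the polynomial \<open>X^3 - p X^2 - q X - r\<close>, of which \<open>\<alpha>\<close> is a root.
\<close>

definition cubic_form :: "'a \<Rightarrow> 'a \<Rightarrow> 'a" where
  "cubic_form Y1 Y2 = Y1^3 - p * Y1^2 * Y2 - q * Y1 * Y2^2 - r * Y2^3"

text \<open>
  The right side is the determinant of the \<open>\<alpha>\<close>- and \<open>\<alpha>^2\<close>-coordinates of \<open>\<beta> = x \<alpha> + y \<alpha>^2\<close> and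
  of \<open>\<beta>^2\<close> (see \<open>square_coords\<close>). The shift of the first argument by \<open>p * y\<close> comes from
  replacing the sum of two roots by \<open>p\<close> minus the third.
\<close>

lemma cubic_form_det:
  "cubic_form (x + p * y) y =
     x * (x^2 + 2 * p * x * y + (p^2 + q) * y^2) - y * (2 * q * x * y + (p * q + r) * y^2)"
  unfolding cubic_form_def by (simp add: algebra_simps eval_nat_numeral)

text \<open>
  If \<open>R[\<beta>] = R[\<alpha>]\<close>, then \<open>\<alpha>\<close> and \<open>\<alpha>^2\<close> are combinations of \<open>1, \<beta>, \<beta>^2\<close>, and comparing
  coordinates yields an inverse over \<open>R\<close> of the 2 by 2 coordinate matrix of \<open>\<beta>\<close> and \<open>\<beta>^2\<close>,
  so its determinant is a unit. Conversely, with a unit determinant Cramer's rule expresses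
  \<open>\<alpha>\<close> by \<open>\<beta>\<close> and \<open>\<beta>^2\<close>.
\<close>

theorem generates_iff_index_unit:
  assumes x: "x \<in> R" and y: "y \<in> R"
  shows "ring_adjoin R (x * \<alpha> + y * \<alpha>^2) = ring_adjoin R \<alpha> \<longleftrightarrow> cubic_form (x + p * y) y \<in> units_in R"
proof -
  define \<beta> where "\<beta> = x * \<alpha> + y * \<alpha>^2"
  define p0 where "p0 = 2 * r * x * y + p * r * y^2"
  define p1 where "p1 = 2 * q * x * y + (p * q + r) * y^2"
  define p2 where "p2 = x^2 + 2 * p * x * y + (p^2 + q) * y^2"
  define D where "D = x * p2 - y * p1"
  have \<beta>2: "\<beta>^2 = p0 + p1 * \<alpha> + p2 * \<alpha>^2"
    unfolding \<beta>_def p0_def p1_def p2_def by (rule square_coords)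
  have in_R: "p0 \<in> R" "p1 \<in> R" "p2 \<in> R"
    unfolding p0_def p1_def p2_def by (intro closed x y coeffs)+
  have D_R: "D \<in> R" unfolding D_def by (intro closed x y in_R)
  have D: "cubic_form (x + p * y) y = D"
    unfolding D_def p1_def p2_def by (rule cubic_form_det)
  have adj: "ring_adjoin R \<beta> = quad_span R \<beta>"
    unfolding \<beta>_def using x y by (rule ring_adjoin_eq_quad_span_no_const)
  have "ring_adjoin R \<beta> = ring_adjoin R \<alpha> \<longleftrightarrow> D \<in> units_in R"
  proof
    assume eq: "ring_adjoin R \<beta> = ring_adjoin R \<alpha>"
    have coords: "\<exists>s1 s2. s1 \<in> R \<and> s2 \<in> R \<and> s1 * x + s2 * p1 = v1 \<and> s1 * y + s2 * p2 = v2"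
      if v: "v0 \<in> R" "v1 \<in> R" "v2 \<in> R" for v0 v1 v2
    proof -
      have "v0 + v1 * \<alpha> + v2 * \<alpha>^2 \<in> quad_span R \<beta>"
        using v eq adj ring_adjoin_eq_quad_span unfolding quad_span_def by blast
      then obtain s0 s1 s2 where s: "s0 \<in> R" "s1 \<in> R" "s2 \<in> R"
        and e: "v0 + v1 * \<alpha> + v2 * \<alpha>^2 = s0 + s1 * \<beta> + s2 * \<beta>^2"
        unfolding quad_span_def by blast
      have "v0 + v1 * \<alpha> + v2 * \<alpha>^2 = (s0 + s2 * p0) + (s1 * x + s2 * p1) * \<alpha> + (s1 * y + s2 * p2) * \<alpha>^2"
        unfolding e \<beta>2 by (simp add: \<beta>_def algebra_simps)
      from independent_eq[OF v _ _ _ this]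
      have "v1 = s1 * x + s2 * p1 \<and> v2 = s1 * y + s2 * p2"
        using s x y in_R by (simp add: closed)
      with s show ?thesis by (intro exI[of _ s1] exI[of _ s2]) simp
    qed
    (* The rows (s1, s2) and (t1, t2) are the inverse of the matrix with rows (x, y) and (p1, p2). *)
    obtain s1 s2 where s: "s1 \<in> R" "s2 \<in> R" "s1 * x + s2 * p1 = 1" "s1 * y + s2 * p2 = 0"
      using coords[OF closed(1,2,1)] by blast
    obtain t1 t2 where t: "t1 \<in> R" "t2 \<in> R" "t1 * x + t2 * p1 = 0" "t1 * y + t2 * p2 = 1"
      using coords[OF closed(1,1,2)] by blast
    have "D * (s1 * t2 - s2 * t1) =
      (s1 * x + s2 * p1) * (t1 * y + t2 * p2) - (s1 * y + s2 * p2) * (t1 * x + t2 * p1)"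
      unfolding D_def by (simp add: algebra_simps)
    also have "\<dots> = 1" by (simp add: s(3,4) t(3,4))
    finally have "D * (s1 * t2 - s2 * t1) = 1" .
    moreover have "s1 * t2 - s2 * t1 \<in> R" by (intro closed s(1,2) t(1,2))
    ultimately show "D \<in> units_in R" unfolding units_in_def using D_R by blast
  next
    assume "D \<in> units_in R"
    then obtain v where v: "v \<in> R" "D * v = 1" unfolding units_in_def by blast
    note S = subring_set_ring_adjoin[OF R]
    (* This combination eliminates the constant term and the coefficient of \<alpha>^2. *)
    have "v * (p2 * \<beta> - y * \<beta>^2 + y * p0) = D * v * \<alpha>"
      unfolding \<beta>2 unfolding \<beta>_def D_def by (simp add: algebra_simps)
    then have "\<alpha> = v * (p2 * \<beta> - y * \<beta>^2 + y * p0)" by (simp add: v)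
    moreover have "v * (p2 * \<beta> - y * \<beta>^2 + y * p0) \<in> ring_adjoin R \<beta>"
      by (intro subring_set_closed[OF S] ring_adjoin_base[OF R] ring_adjoin_self[OF R] v y in_R)
    ultimately have "ring_adjoin R \<alpha> \<subseteq> ring_adjoin R \<beta>"
      by (intro ring_adjoin_subset[OF R]) simp
    moreover have "\<beta> \<in> ring_adjoin R \<alpha>"
      unfolding \<beta>_def
      by (intro subring_set_closed[OF S] ring_adjoin_base[OF R] ring_adjoin_self[OF R] x y)
    then have "ring_adjoin R \<beta> \<subseteq> ring_adjoin R \<alpha>" by (rule ring_adjoin_subset[OF R])
    ultimately show "ring_adjoin R \<beta> = ring_adjoin R \<alpha>" by blast
  qed
  then show ?thesis unfolding D \<beta>_def .
qed

end

section \<open>Quadratic algebraic integers\<close>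

text \<open>
  The integral form of the statement that the minimal polynomial of an algebraic integer has integer
  coefficients. A monic \<open>f\<close> that vanishes at \<open>x\<close> satisfies \<open>c f = g h\<close> by pseudo-division; by Gauss's
  lemma the content of \<open>h\<close> is \<open>\<bar>c\<bar>\<close>, so \<open>c\<close> cancels against \<open>h\<close> and the leading coefficient of \<open>g\<close>
  divides that of \<open>f\<close>, which is 1.
\<close>

lemma algebraic_int_primitive_lead_unit:
  fixes x :: "'a::field_char_0" and g :: "int poly"
  assumes x: "algebraic_int x" and root: "poly (map_poly of_int g) x = 0" and prim: "content g = 1"
    and min: "\<And>h :: int poly. \<lbrakk>poly (map_poly of_int h) x = 0; degree h < degree g\<rbrakk> \<Longrightarrow> h = 0"
  shows "is_unit (lead_coeff g)"
proof -
  have hom: "poly (map_poly of_int (h * k)) x = poly (map_poly of_int h) x * poly (map_poly of_int k) x"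
    "poly (map_poly of_int (h + k)) x = poly (map_poly of_int h) x + poly (map_poly of_int k) x"
    "poly (map_poly of_int (smult c h)) x = of_int c * poly (map_poly of_int h) x"
    for h k :: "int poly" and c
  proof -
    have "map_poly of_int (h * k) = map_poly of_int h * (map_poly of_int k :: 'a poly)"
      by (simp add: poly_eq_iff coeff_map_poly coeff_mult)
    moreover have "map_poly of_int (h + k) = map_poly of_int h + (map_poly of_int k :: 'a poly)"
      by (simp add: poly_eq_iff coeff_map_poly)
    moreover have "map_poly of_int (smult c h) = smult (of_int c) (map_poly of_int h :: 'a poly)"
      by (simp add: poly_eq_iff coeff_map_poly)
    ultimately show
      "poly (map_poly of_int (h * k)) x = poly (map_poly of_int h) x * poly (map_poly of_int k) x"
      "poly (map_poly of_int (h + k)) x = poly (map_poly of_int h) x + poly (map_poly of_int k) x"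
      "poly (map_poly of_int (smult c h)) x = of_int c * poly (map_poly of_int h) x"
      by simp_all
  qed
  obtain f :: "int poly" where f: "poly (map_poly of_int f) x = 0" "lead_coeff f = 1"
    using x unfolding algebraic_int_altdef_ipoly by blast
  have "g \<noteq> 0" using prim by auto
  from pseudo_mod[OF this, of f] obtain c h where c: "c \<noteq> 0"
    and div: "smult c f = g * h + pseudo_mod f g"
    and deg: "pseudo_mod f g = 0 \<or> degree (pseudo_mod f g) < degree g"
    by blast
  have "poly (map_poly of_int (pseudo_mod f g)) x = 0"
    using arg_cong[OF div, of "\<lambda>h. poly (map_poly of_int h) x"] f(1) root by (simp only: hom) simp
  with deg min have "pseudo_mod f g = 0" by blast
  with div have eq: "smult c f = g * h" by simp
  have "content f dvd 1" using content_dvd_coeff[of f "degree f"] f(2) by simp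
  then have "content f = 1" by (metis is_unit_content_iff)
  with arg_cong[OF eq, of content] have "normalize c = content h"
    by (simp add: content_mult prim)
  then have "c dvd lead_coeff h" by (metis content_dvd_coeff normalize_dvd_iff)
  moreover have "c = lead_coeff g * lead_coeff h"
    using arg_cong[OF eq, of lead_coeff] f(2) c by (simp add: lead_coeff_mult)
  ultimately show ?thesis using c by auto
qed

text \<open>
  Trace and norm of a quadratic irrational algebraic integer are integers: clear denominators in
  its equation and pass to the primitive part, whose leading coefficient is a unit by the previous
  lemma. Hence the common denominator \<open>m\<close> divides the content.
\<close>

lemma quadratic_algebraic_int_coeffs:
  fixes x :: "'a::field_char_0"
  assumes x: "algebraic_int x" "x \<notin> \<rat>" and T: "T \<in> \<rat>" and N: "N \<in> \<rat>"
    and quad: "x^2 = T * x - N"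
  shows "T \<in> \<int>" and "N \<in> \<int>"
proof -
  obtain a b where ab: "b > 0" "T = of_int a / of_int b" using T by (elim Rats_cases') auto
  obtain c e where ce: "e > 0" "N = of_int c / of_int e" using N by (elim Rats_cases') auto
  define m t n where "m = b * e" and "t = a * e" and "n = c * b"
  have m: "m \<noteq> 0" "T = of_int t / of_int m" "N = of_int n / of_int m"
    using ab ce by (simp_all add: m_def t_def n_def)
  define G where "G = [:n, - t, m:]"
  define k where "k = content G"
  define g where "g = primitive_part G"
  have G: "smult k g = G" unfolding k_def g_def by (rule content_times_primitive_part)
  have "G \<noteq> 0" using m by (simp add: G_def)
  then have k: "k \<noteq> 0" by (simp add: k_def)
  have deg: "degree g = 2" unfolding g_def using m by (simp add: G_def)
  have "is_unit (lead_coeff g)"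
  proof (rule algebraic_int_primitive_lead_unit[OF x(1)])
    have "map_poly of_int G = smult (of_int k) (map_poly of_int g :: 'a poly)"
      unfolding G[symmetric] by (simp add: poly_eq_iff coeff_map_poly)
    moreover have "poly (map_poly of_int G) x = of_int m * (x^2 - (T * x - N))"
      using m by (simp add: G_def map_poly_pCons field_simps power2_eq_square)
    ultimately show "poly (map_poly of_int g) x = 0" using k quad by simp
    show "content g = 1" unfolding g_def using \<open>G \<noteq> 0\<close> by simp
  next
    fix h :: "int poly" assume h: "poly (map_poly of_int h) x = 0" "degree h < degree g"
    obtain h0 h1 where h01: "h = [:h0, h1:]"
      using h(2) deg by (metis degree_eq_zeroE degree_pCons_eq_if less_2_cases pCons_cases Suc_inject One_nat_def pCons_0_0)
    have root: "of_int h0 + x * of_int h1 = 0" using h(1) by (simp add: h01 map_poly_pCons)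
    have "h1 = 0"
    proof (rule ccontr)
      assume "h1 \<noteq> 0"
      with root have "x = - of_int h0 / of_int h1" by (simp add: field_simps eq_neg_iff_add_eq_0)
      then have "x \<in> \<rat>" by simp
      with x(2) show False ..
    qed
    with root show "h = 0" by (simp add: h01)
  qed
  moreover have "m = k * lead_coeff g"
    using arg_cong[OF G, of lead_coeff] m k by (simp add: G_def)
  ultimately have "m dvd k" by (metis dvd_refl mult_dvd_mono mult.right_neutral one_dvd dvd_mult_unit_iff)
  moreover have "k dvd t" "k dvd n"
    using content_dvd_coeff[of G 1] content_dvd_coeff[of G 0] by (simp_all add: k_def G_def)
  ultimately have "m dvd t" "m dvd n" by (auto intro: dvd_trans)
  then show "T \<in> \<int>" "N \<in> \<int>" using m by (auto simp: dvd_def)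
qed

lemma quadratic_imp_algebraic_int:
  fixes x :: "'a::field_char_0"
  assumes "x^2 = of_int t * x - of_int n"
  shows "algebraic_int x"
proof (rule algebraic_int.intros)
  show "lead_coeff [:of_int n, - of_int t, 1 :: 'a:] = 1" by simp
  show "\<forall>i. coeff [:of_int n, - of_int t, 1 :: 'a:] i \<in> \<int>"
    by (auto simp: coeff_pCons split: nat.split)
  show "poly [:of_int n, - of_int t, 1 :: 'a:] x = 0"
    using assms by (simp add: algebra_simps power2_eq_square)
qed

text \<open>
  A denominator of \<open>w\<close> enters squared and cannot be absorbed by \<open>d\<close>.
\<close>

lemma squarefree_mult_square_int:
  fixes w :: real
  assumes d: "squarefree d" and w: "w \<in> \<rat>" and int: "of_int d * w^2 \<in> \<int>"
  shows "w \<in> \<int>"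
proof -
  obtain a b where ab: "b > 0" "coprime a b" "w = of_int a / of_int b" using w by (elim Rats_cases')
  obtain k where "of_int d * w^2 = (of_int k :: real)" using int by (elim Ints_cases)
  then have "of_int (d * a^2) = (of_int (k * b^2) :: real)"
    using ab by (simp add: field_simps)
  then have "d * a^2 = k * b^2" by (simp only: of_int_eq_iff)
  then have "b^2 dvd d * a^2" by simp
  moreover have "coprime (b^2) (a^2)" using ab(2) by (simp add: coprime_commute)
  ultimately have "b^2 dvd d" by (simp add: coprime_dvd_mult_left_iff)
  with d have "b dvd 1" by (rule squarefreeD)
  with ab show ?thesis by simp
qed

section \<open>The ring of integers of an imaginary quadratic field\<close>

lemma imag_sqrt_square:
  assumes "d > 0"
  shows "imag_sqrt d ^ 2 = - of_int d"
  using assms by (simp add: imag_sqrt_def power_mult_distrib flip: of_real_power)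

lemma Re_Im_imag_sqrt: "Re (imag_sqrt d) = 0" "Im (imag_sqrt d) = sqrt (of_int d)"
  by (simp_all add: imag_sqrt_def)

lemma subfield_set_field_adjoin: "subfield_set (field_adjoin F x)"
  unfolding subfield_set_def field_adjoin_def by blast

lemma field_adjoin_self: "x \<in> field_adjoin F x"
  unfolding field_adjoin_def by blast

lemma field_adjoin_minimal:
  "\<lbrakk>subfield_set L; F \<subseteq> L; x \<in> L\<rbrakk> \<Longrightarrow> field_adjoin F x \<subseteq> L"
  unfolding field_adjoin_def by blast

lemma subfield_setD:
  assumes "subfield_set F"
  shows subfield_set_subring: "subring_set F"
    and subfield_set_divide: "x \<in> F \<Longrightarrow> y \<in> F \<Longrightarrow> x / y \<in> F"
  using assms by (auto simp: subring_set_def subfield_set_def divide_inverse)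

lemma subfield_set_imag_quad_field: "subfield_set (imag_quad_field d)"
  unfolding imag_quad_field_def by (rule subfield_set_field_adjoin)

lemma complex_of_real_of_rat [simp]: "complex_of_real (of_rat c) = of_rat c"
  by (cases c) (simp add: of_rat_rat)

lemma imag_quad_field_coords:
  assumes d: "d > 0" and z: "z \<in> imag_quad_field d"
  obtains u v where "u \<in> \<rat>" "v \<in> \<rat>" "z = of_real u + of_real v * imag_sqrt d"
proof -
  define s where "s = imag_sqrt d"
  have s2: "s * s = - of_int d"
    using imag_sqrt_square[OF d] by (simp add: s_def power2_eq_square)
  define L where "L = {of_real u + of_real v * s |u v. u \<in> \<rat> \<and> v \<in> \<rat>}"
  have L: "of_real u + of_real v * s \<in> L" if "u \<in> \<rat>" "v \<in> \<rat>" for u v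
    using that unfolding L_def by blast
  have "subfield_set L"
    unfolding subfield_set_def
  proof (intro conjI ballI)
    show "0 \<in> L" using L[of 0 0] by simp
    show "1 \<in> L" using L[of 1 0] by simp
    fix x assume "x \<in> L"
    then obtain u v where uv: "u \<in> \<rat>" "v \<in> \<rat>" "x = of_real u + of_real v * s"
      unfolding L_def by blast
    show "- x \<in> L" using L[of "- u" "- v"] uv by simp
    show "inverse x \<in> L"
    proof (cases "x = 0")
      case True
      then show ?thesis using L[of 0 0] by simp
    next
      case False
      define n where "n = u^2 + of_int d * v^2"
      have "u \<noteq> 0 \<or> v \<noteq> 0" using False uv(3) by auto
      then have "n > 0"
        using d unfolding n_def by (auto intro: add_pos_nonneg add_nonneg_pos)
      then have n: "complex_of_real n \<noteq> 0" by simp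
      (* Rationalise the denominator; n is the norm of x. *)
      have "x * (of_real u - of_real v * s) = of_real u * of_real u - of_real v * of_real v * (s * s)"
        unfolding uv(3) by (simp add: algebra_simps)
      also have "\<dots> = of_real n" unfolding s2 n_def by (simp add: power2_eq_square)
      finally have "inverse x = (of_real u - of_real v * s) / of_real n"
        using n False by (simp add: field_simps)
      also have "\<dots> = of_real (u / n) + of_real (- v / n) * s"
        using n by (simp add: field_simps)
      finally show ?thesis
        using L[of "u / n" "- v / n"] uv by (simp add: n_def)
    qed
    fix y assume "y \<in> L"
    then obtain u' v' where uv': "u' \<in> \<rat>" "v' \<in> \<rat>" "y = of_real u' + of_real v' * s"
      unfolding L_def by blast
    have "x + y = of_real (u + u') + of_real (v + v') * s"
      unfolding uv uv' by (simp add: algebra_simps)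
    then show "x + y \<in> L" using L[of "u + u'" "v + v'"] uv(1,2) uv'(1,2) by (simp only: Rats_add)
    have "x * y = of_real u * of_real u' + of_real v * of_real v' * (s * s)
      + (of_real u * of_real v' + of_real v * of_real u') * s"
      unfolding uv uv' by (simp add: algebra_simps)
    then have "x * y = of_real (u * u' - of_int d * v * v') + of_real (u * v' + v * u') * s"
      unfolding s2 by (simp add: algebra_simps)
    then show "x * y \<in> L"
      using L[of "u * u' - of_int d * v * v'" "u * v' + v * u'"] uv(1,2) uv'(1,2)
      by (simp only: Rats_add Rats_diff Rats_mult Rats_of_int)
  qed
  moreover have "\<rat> \<subseteq> L"
  proof
    fix x :: complex assume "x \<in> \<rat>"
    then obtain c where "x = of_rat c" by (elim Rats_cases)
    then have "x = of_real (of_rat c) + of_real 0 * s" by simp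
    then show "x \<in> L" using L[of "of_rat c" 0] by simp
  qed
  moreover have "s \<in> L" using L[of 0 1] by simp
  ultimately have "imag_quad_field d \<subseteq> L"
    unfolding imag_quad_field_def s_def[symmetric] by (intro field_adjoin_minimal)
  with z that show thesis unfolding L_def s_def by blast
qed

lemma quad_omega_quadratic:
  assumes "d > 0"
  obtains t n where "quad_omega d ^ 2 = of_int t * quad_omega d - of_int n"
proof (cases "(- d) mod 4 = 1")
  case True
  then have "4 dvd d + 1" by presburger
  then obtain n where n: "d + 1 = 4 * n" by blast
  have "quad_omega d ^ 2 = (1 + 2 * imag_sqrt d + imag_sqrt d ^ 2) / 4"
    using True by (simp add: quad_omega_def power2_eq_square algebra_simps)
  also have "\<dots> = quad_omega d - of_int (d + 1) / 4"
    using True by (simp add: imag_sqrt_square[OF assms] quad_omega_def field_simps)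
  also have "\<dots> = of_int 1 * quad_omega d - of_int n" by (simp add: n)
  finally show thesis by (rule that)
next
  case False
  then have "quad_omega d ^ 2 = of_int 0 * quad_omega d - of_int d"
    by (simp add: quad_omega_def imag_sqrt_square[OF assms])
  then show thesis by (rule that)
qed

lemma omega_combination_quadratic:
  fixes w :: "'a::comm_ring_1"
  assumes "w^2 = of_int t * w - of_int n"
  shows "(of_int x + of_int y * w)^2 =
    of_int (2 * x + y * t) * (of_int x + of_int y * w) - of_int (x^2 + x * y * t + y^2 * n)"
proof -
  have "(of_int x + of_int y * w)^2 = of_int (x^2) + of_int (2 * x * y) * w + of_int (y^2) * w^2"
    by (simp add: algebra_simps power2_eq_square)
  also have "\<dots> = of_int (2 * x + y * t) * (of_int x + of_int y * w) - of_int (x^2 + x * y * t + y^2 * n)"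
    unfolding assms by (simp add: algebra_simps power2_eq_square)
  finally show ?thesis .
qed

text \<open>
  Here \<open>A / 2\<close> and \<open>B / 2\<close> are the rational coordinates of an integer of \<open>M\<close>, and \<open>N\<close> is its norm.
  Squares are 0 or 1 modulo 4, and square-freeness excludes \<open>d\<close> divisible by 4. So \<open>A\<close> and
  \<open>B\<close> are both even unless \<open>d\<close> is 3 modulo 4, when only their parities have to agree.
\<close>

lemma half_integral_coords:
  fixes A B N d :: int
  assumes d: "squarefree d" and eq: "A^2 + d * B^2 = 4 * N"
  shows "(- d) mod 4 = 1 \<Longrightarrow> even (A - B)"
    and "(- d) mod 4 \<noteq> 1 \<Longrightarrow> even A \<and> even B"
proof -
  assume "(- d) mod 4 = 1"
  then have "odd d" by presburger
  have "even (A^2 + d * B^2)" unfolding eq by simp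
  with \<open>odd d\<close> show "even (A - B)" by simp
next
  assume d3: "(- d) mod 4 \<noteq> 1"
  have "\<not> 2^2 dvd d" using squarefreeD[OF d, of 2] by auto
  then have d0: "d mod 4 \<noteq> 0" by (simp add: dvd_eq_mod_eq_0)
  have sq: "x^2 mod 4 = (if even x then 0 else 1)" for x :: int
  proof (cases "even x")
    case True
    then show ?thesis by (auto elim!: evenE simp: power2_eq_square)
  next
    case False
    then obtain k where "x = 2 * k + 1" by (elim oddE)
    then have "x^2 = 4 * (k^2 + k) + 1" by (simp add: power2_eq_square algebra_simps)
    moreover have "(4 * c + 1) mod 4 = 1" for c :: int by presburger
    ultimately have "x^2 mod 4 = 1" by metis
    with False show ?thesis by simp
  qed
  have "(A^2 mod 4 + (d mod 4) * (B^2 mod 4)) mod 4 = 0"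
  proof -
    have "(A^2 mod 4 + (d mod 4) * (B^2 mod 4)) mod 4 = (A^2 + ((d mod 4) * (B^2 mod 4)) mod 4) mod 4"
      by (simp only: mod_add_left_eq mod_add_right_eq)
    also have "\<dots> = (A^2 + d * B^2) mod 4" by (simp only: mod_mult_eq mod_add_right_eq)
    finally show ?thesis by (simp add: eq)
  qed
  moreover have "d mod 4 = 1 \<or> d mod 4 = 2" using d0 d3 by presburger
  ultimately show "even A \<and> even B" unfolding sq by (auto split: if_splits)
qed

text \<open>
  For \<open>u + v \<surd>-d\<close> outside \<open>\<rat>\<close>, integrality gives that the trace \<open>2 u\<close> and the norm \<open>u^2 + d v^2\<close> are
  integers, whence so is \<open>d (2 v)^2\<close> and, \<open>d\<close> being square-free, \<open>2 v\<close>. The rest is the parity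
  analysis above. Conversely \<open>\<omega>\<close>, and with it every element of \<open>\<int> + \<int>\<omega>\<close>, is a root of a monic
  quadratic polynomial over \<open>\<int>\<close>.
\<close>

theorem imag_quad_ints_eq:
  assumes d: "d > 0" and sf: "squarefree d"
  shows "imag_quad_ints d = {of_int m + of_int n * quad_omega d |m n. True}"
proof (intro equalityI subsetI)
  fix z assume "z \<in> imag_quad_ints d"
  then have zF: "z \<in> imag_quad_field d" and za: "algebraic_int z"
    by (simp_all add: ring_of_integers_def)
  define s where "s = imag_sqrt d"
  obtain u v where uv: "u \<in> \<rat>" "v \<in> \<rat>" and z: "z = of_real u + of_real v * s"
    unfolding s_def using d zF by (elim imag_quad_field_coords)
  show "z \<in> {of_int m + of_int n * quad_omega d |m n. True}"
  proof (cases "v = 0")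
    case True
    from uv(1) obtain c where "u = of_rat c" by (elim Rats_cases)
    then have "z \<in> \<rat>" using True by (simp add: z)
    with za have "z \<in> \<int>" by (rule rational_algebraic_int_is_int)
    then obtain k where "z = of_int k + of_int 0 * quad_omega d" by (auto elim: Ints_cases)
    then show ?thesis by blast
  next
    case False
    have of_real_Rats: "complex_of_real x \<in> \<rat>" if "x \<in> \<rat>" for x
      using that by (auto elim!: Rats_cases)
    have of_real_Ints: "x \<in> \<int>" if "complex_of_real x \<in> \<int>" for x
      using that by (metis Ints_cases Ints_of_int of_real_of_int_eq of_real_eq_iff)
    have "Im z \<noteq> 0" using False d by (simp add: z s_def Re_Im_imag_sqrt)
    moreover have "Im (of_rat c) = 0" for c
      using Im_complex_of_real[of "of_rat c"] by simp
    ultimately have irrat: "z \<notin> \<rat>" by (auto elim!: Rats_cases)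
    have "z^2 = of_real (2 * u) * z - of_real (u^2) + of_real (v^2) * s^2"
      unfolding z by (simp add: algebra_simps power2_eq_square)
    also have "\<dots> = of_real (2 * u) * z - of_real (u^2 + of_int d * v^2)"
      by (simp add: s_def imag_sqrt_square[OF d])
    finally have quad: "z^2 = of_real (2 * u) * z - of_real (u^2 + of_int d * v^2)" .
    note ints = quadratic_algebraic_int_coeffs[OF za irrat _ _ quad]
    have "2 * u \<in> \<int>" "u^2 + of_int d * v^2 \<in> \<int>"
      using uv by (auto intro!: of_real_Ints ints of_real_Rats simp del: of_real_add of_real_mult of_real_power)
    then obtain A N where A: "2 * u = of_int A" and N: "u^2 + of_int d * v^2 = of_int N"
      by (elim Ints_cases)
    have "of_int d * (2 * v)^2 = 4 * (u^2 + of_int d * v^2) - (2 * u)^2"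
      by (simp add: power2_eq_square algebra_simps)
    also have "\<dots> = of_int (4 * N - A^2)" unfolding A N by simp
    finally have dv: "of_int d * (2 * v)^2 = of_int (4 * N - A^2)" .
    have "2 * v \<in> \<int>"
    proof (rule squarefree_mult_square_int[OF sf])
      show "2 * v \<in> \<rat>" using uv(2) by simp
      show "of_int d * (2 * v)^2 \<in> \<int>" unfolding dv by (rule Ints_of_int)
    qed
    then obtain B where B: "2 * v = of_int B" by (elim Ints_cases)
    have "real_of_int (d * B^2) = of_int (4 * N - A^2)"
      using dv unfolding B by (simp only: of_int_mult of_int_power)
    then have "d * B^2 = 4 * N - A^2" by (simp only: of_int_eq_iff)
    then have eq: "A^2 + d * B^2 = 4 * N" by simp
    have z2: "z = (of_int A + of_int B * s) / 2"
    proof -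
      have "2 * z = of_real (2 * u) + of_real (2 * v) * s" by (simp add: z algebra_simps)
      then show ?thesis unfolding A B by (simp add: mult.commute)
    qed
    show ?thesis
    proof (cases "(- d) mod 4 = 1")
      case True
      from half_integral_coords(1)[OF sf eq True] obtain k where k: "A - B = 2 * k" by (elim evenE)
      then have "A = B + 2 * k" by simp
      then have "z = of_int k + of_int B * quad_omega d"
        using True by (simp add: z2 quad_omega_def s_def field_simps)
      then show ?thesis by blast
    next
      case False
      from half_integral_coords(2)[OF sf eq False] obtain k l where "A = 2 * k" "B = 2 * l"
        by (elim conjE evenE)
      then have "z = of_int k + of_int l * quad_omega d"
        using False by (simp add: z2 quad_omega_def s_def field_simps)
      then show ?thesis by blast
    qed
  qed
next
  fix z assume "z \<in> {of_int m + of_int n * quad_omega d |m n. True}"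
  then obtain m n where z: "z = of_int m + of_int n * quad_omega d" by blast
  note closed = subring_set_closed[OF subfield_set_subring[OF subfield_set_imag_quad_field[of d]]]
  note int = of_int_mem_subfield_set[OF subfield_set_imag_quad_field[of d]]
  have "imag_sqrt d \<in> imag_quad_field d"
    unfolding imag_quad_field_def by (rule field_adjoin_self)
  then have "quad_omega d \<in> imag_quad_field d"
    unfolding quad_omega_def
    by (auto intro: closed subfield_set_divide[OF subfield_set_imag_quad_field])
  then have "z \<in> imag_quad_field d" unfolding z by (intro closed int)
  moreover obtain t k where "quad_omega d ^ 2 = of_int t * quad_omega d - of_int k"
    using d by (elim quad_omega_quadratic)
  from omega_combination_quadratic[OF this] have "algebraic_int z"
    unfolding z by (rule quadratic_imp_algebraic_int)
  ultimately show "z \<in> imag_quad_ints d" by (simp add: ring_of_integers_def)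
qed

lemma imag_quad_ints_quadratic:
  assumes "d > 0" and "squarefree d" and "z \<in> imag_quad_ints d"
  obtains t n where "z^2 = of_int t * z - of_int n"
proof -
  obtain x y where z: "z = of_int x + of_int y * quad_omega d"
    using assms(3) unfolding imag_quad_ints_eq[OF assms(1,2)] by blast
  obtain t k where "quad_omega d ^ 2 = of_int t * quad_omega d - of_int k"
    using assms(1) by (elim quad_omega_quadratic)
  from omega_combination_quadratic[OF this] that show thesis unfolding z by blast
qed

lemma subring_set_imag_quad_ints:
  assumes d: "d > 0" and sf: "squarefree d"
  shows "subring_set (imag_quad_ints d)"
proof -
  define w where "w = quad_omega d"
  obtain t k where w2: "w^2 = of_int t * w - of_int k"
    unfolding w_def using d by (elim quad_omega_quadratic)
  define S where "S = {of_int m + of_int n * w |m n. True}"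
  have S: "of_int m + of_int n * w \<in> S" for m n unfolding S_def by blast
  have "subring_set S"
    unfolding subring_set_def
  proof (intro conjI ballI)
    show "1 \<in> S" using S[of 1 0] by simp
    fix x assume "x \<in> S"
    then obtain m n where x: "x = of_int m + of_int n * w" unfolding S_def by blast
    show "- x \<in> S" using S[of "- m" "- n"] by (simp add: x)
    fix y assume "y \<in> S"
    then obtain m' n' where y: "y = of_int m' + of_int n' * w" unfolding S_def by blast
    show "x + y \<in> S" using S[of "m + m'" "n + n'"] by (simp add: x y algebra_simps)
    have "x * y = of_int (m * m') + of_int (m * n' + n * m') * w + of_int (n * n') * w^2"
      by (simp add: x y algebra_simps power2_eq_square)
    also have "\<dots> = of_int (m * m' - n * n' * k) + of_int (m * n' + n * m' + n * n' * t) * w"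
      unfolding w2 by (simp add: algebra_simps)
    finally show "x * y \<in> S" by (simp only: S)
  qed
  then show ?thesis unfolding imag_quad_ints_eq[OF d sf] S_def w_def .
qed

section \<open>The simplest cubic polynomials over imaginary quadratic fields\<close>

lemma poly_simplest_cubic:
  "poly (simplest_cubic a) x = x^3 - of_int a * x^2 - (of_int a + 3) * x - 1"
  by (simp add: simplest_cubic_def algebra_simps eval_nat_numeral)

lemma simplest_cubic_odd: "odd (m^3 - a * m^2 - (a + 3) * m - 1)" for a m :: int
  by (cases "even m") simp_all

lemma simplest_cubic_no_int_root: "poly (simplest_cubic a) (of_int m) \<noteq> 0"
proof
  assume "poly (simplest_cubic a) (of_int m) = 0"
  then have "(of_int (m^3 - a * m^2 - (a + 3) * m - 1) :: complex) = 0"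
    by (simp add: poly_simplest_cubic)
  then have "m^3 - a * m^2 - (a + 3) * m - 1 = 0" by (simp only: of_int_eq_0_iff)
  with simplest_cubic_odd[of m a] show False by simp
qed

lemma algebraic_int_simplest_cubic_root:
  assumes "poly (simplest_cubic a) x = 0"
  shows "algebraic_int x"
  using assms
  by (intro algebraic_int.intros[of "simplest_cubic a"])
    (auto simp: simplest_cubic_def coeff_pCons split: nat.split)

text \<open>
  A root \<open>z\<close> in \<open>M\<close> is an algebraic integer and satisfies \<open>z^2 - t z + n = 0\<close> over \<open>\<int>\<close>. Divide \<open>f\<close> by
  this quadratic polynomial, with quotient \<open>X - (a - t)\<close> and remainder \<open>e X + g\<close>. As \<open>z\<close> is
  irrational, the remainder vanishes, and \<open>a - t\<close> is an integer root of \<open>f\<close>, against parity.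
\<close>

lemma simplest_cubic_no_root:
  assumes d: "d > 0" and sf: "squarefree d" and z: "z \<in> imag_quad_field d"
  shows "poly (simplest_cubic a) z \<noteq> 0"
proof
  assume root: "poly (simplest_cubic a) z = 0"
  then have za: "algebraic_int z" by (rule algebraic_int_simplest_cubic_root)
  then have "z \<in> imag_quad_ints d" using z by (simp add: ring_of_integers_def)
  then obtain t n where quad: "z^2 = of_int t * z - of_int n"
    using d sf by (elim imag_quad_ints_quadratic)
  have irrat: "z \<notin> \<rat>"
    using za root simplest_cubic_no_int_root by (metis Ints_cases rational_algebraic_int_is_int)
  define e where "e = t^2 - n - a * t - (a + 3)"
  define g where "g = - t * n + a * n - 1"
  have "z^3 = z * z^2" by (simp add: eval_nat_numeral)
  also have "\<dots> = z * (of_int t * z - of_int n)" by (simp only: quad)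
  also have "\<dots> = of_int t * z^2 - of_int n * z" by (simp add: algebra_simps power2_eq_square)
  also have "\<dots> = of_int t * (of_int t * z - of_int n) - of_int n * z" by (simp only: quad)
  finally have z3: "z^3 = of_int t * (of_int t * z - of_int n) - of_int n * z" .
  have "of_int e * z + of_int g = poly (simplest_cubic a) z"
    unfolding poly_simplest_cubic z3 quad e_def g_def
    by (simp add: algebra_simps power2_eq_square)
  with root have lin: "of_int e * z + of_int g = 0" by simp
  have "e = 0"
  proof (rule ccontr)
    assume "e \<noteq> 0"
    with lin have "z = - of_int g / of_int e" by (simp add: field_simps eq_neg_iff_add_eq_0)
    then have "z \<in> \<rat>" by simp
    with irrat show False ..
  qed
  moreover from this lin have "g = 0" by simp
  (* The quotient X - (a - t) vanishes at a - t, so only the remainder is left. *)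
  moreover have "(a - t)^3 - a * (a - t)^2 - (a + 3) * (a - t) - 1 = e * (a - t) + g"
    unfolding e_def g_def by (simp add: algebra_simps power2_eq_square power3_eq_cube)
  ultimately have "(a - t)^3 - a * (a - t)^2 - (a + 3) * (a - t) - 1 = 0" by simp
  with simplest_cubic_odd[of "a - t" a] show False by simp
qed

text \<open>
  A cubic polynomial without a root in \<open>F\<close> is irreducible over \<open>F\<close>. If \<open>x\<close> satisfied a quadratic
  equation \<open>x^2 = s x + t\<close> over \<open>F\<close>, the cubic would reduce to a linear relation for \<open>x\<close>, which has
  to be trivial as \<open>x\<close> is not in \<open>F\<close>; so the quadratic divides the cubic, and the linear
  cofactor contributes the root \<open>p - s\<close>.
\<close>

lemma cubic_root_independent:
  fixes F :: "'a::field set"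
  assumes F: "subfield_set F" and coeffs: "p \<in> F" "q \<in> F" "r \<in> F"
    and cubic: "x^3 = p * x^2 + q * x + r"
    and no_root: "\<And>y. y \<in> F \<Longrightarrow> y^3 \<noteq> p * y^2 + q * y + r"
    and u: "u0 \<in> F" "u1 \<in> F" "u2 \<in> F" and rel: "u0 + u1 * x + u2 * x^2 = 0"
  shows "u0 = 0 \<and> u1 = 0 \<and> u2 = 0"
proof -
  note closed = subring_set_closed[OF subfield_set_subring[OF F]] subfield_set_divide[OF F]
  have not_in_F: "x \<notin> F" using cubic no_root by blast
  have linear: "c = 0 \<and> e = 0" if "c \<in> F" "e \<in> F" "c + e * x = 0" for c e
  proof -
    have "e = 0"
    proof (rule ccontr)
      assume "e \<noteq> 0"
      with that(3) have "x = - c / e" by (simp add: field_simps eq_neg_iff_add_eq_0)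
      moreover have "- c / e \<in> F" by (intro closed that)
      ultimately show False using not_in_F by simp
    qed
    with that(3) show ?thesis by simp
  qed
  have "u2 = 0"
  proof (rule ccontr)
    assume u2: "u2 \<noteq> 0"
    define s t where "s = - u1 / u2" and "t = - u0 / u2"
    have st: "s \<in> F" "t \<in> F" unfolding s_def t_def by (intro closed u)+
    have "u2 * x^2 + (u0 + u1 * x) = 0" using rel by (simp only: add_ac)
    then have "x^2 * u2 = - (u0 + u1 * x)"
      unfolding eq_neg_iff_add_eq_0 by (simp only: mult.commute[of "x^2"])
    then have "x^2 = - (u0 + u1 * x) / u2" by (rule nonzero_eq_divide_eq[THEN iffD2, OF u2])
    then have sq: "x^2 = s * x + t"
      using u2 by (simp add: s_def t_def add_divide_distrib diff_divide_distrib)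
    have "x^3 = x * x^2" by (simp add: eval_nat_numeral)
    also have "\<dots> = s * x^2 + t * x" by (simp add: sq algebra_simps flip: power2_eq_square)
    finally have "(s * t - p * t - r) + (s^2 + t - p * s - q) * x = 0"
      using cubic unfolding sq by (simp add: algebra_simps power2_eq_square)
    moreover have "s * t - p * t - r \<in> F" "s^2 + t - p * s - q \<in> F"
      by (intro closed st coeffs)+
    ultimately have "s * t - p * t - r = 0" "s^2 + t - p * s - q = 0" using linear by blast+
    then have rq: "r = s * t - p * t" "q = s^2 + t - p * s" by (simp_all add: algebra_simps)
    have "(p - s)^3 = p * (p - s)^2 + q * (p - s) + r"
      unfolding rq by (simp add: algebra_simps power2_eq_square power3_eq_cube)
    moreover have "p - s \<in> F" by (intro closed st coeffs)
    ultimately show False using no_root by blast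
  qed
  with rel linear[OF u(1,2)] show ?thesis by simp
qed

lemma cubic_order_simplest_cubic:
  assumes d: "d > 0" and sf: "squarefree d" and root: "poly (simplest_cubic a) \<alpha> = 0"
  shows "cubic_order (imag_quad_ints d) \<alpha> (of_int a) (of_int a + 3) 1"
proof
  let ?R = "imag_quad_ints d" and ?M = "imag_quad_field d"
  show R: "subring_set ?R" using d sf by (rule subring_set_imag_quad_ints)
  have "of_int a + of_int 0 * quad_omega d \<in> ?R" unfolding imag_quad_ints_eq[OF d sf] by blast
  then show a: "of_int a \<in> ?R" by simp
  with R show "of_int a + 3 \<in> ?R" "1 \<in> ?R" by (simp_all add: subring_set_closed)
  note coeffs = a this
  have cubic_iff: "x^3 = of_int a * x^2 + (of_int a + 3) * x + 1 \<longleftrightarrow> poly (simplest_cubic a) x = 0" for x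
    unfolding poly_simplest_cubic by (auto simp: algebra_simps)
  show cubic: "\<alpha>^3 = of_int a * \<alpha>^2 + (of_int a + 3) * \<alpha> + 1" using root cubic_iff by blast
  fix u0 u1 u2 assume u: "u0 \<in> ?R" "u1 \<in> ?R" "u2 \<in> ?R" "u0 + u1 * \<alpha> + u2 * \<alpha>^2 = 0"
  have sub: "?R \<subseteq> ?M" by (auto simp: ring_of_integers_def)
  show "u0 = 0 \<and> u1 = 0 \<and> u2 = 0"
  proof (rule cubic_root_independent[OF subfield_set_imag_quad_field _ _ _ cubic _ _ _ _ u(4)])
    fix y assume "y \<in> ?M"
    then show "y^3 \<noteq> of_int a * y^2 + (of_int a + 3) * y + 1"
      using simplest_cubic_no_root[OF d sf] cubic_iff by blast
  qed (use coeffs u sub in blast)+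
qed

lemma sextic_order_eq_quad_span:
  assumes "d > 0" and "squarefree d"
  shows "sextic_order d \<alpha> = quad_span (imag_quad_ints d) \<alpha>"
proof (intro equalityI subsetI)
  fix z assume "z \<in> sextic_order d \<alpha>"
  then obtain x0 x1 x2 y0 y1 y2 where z: "z = of_int x0 + of_int x1 * \<alpha> + of_int x2 * \<alpha>^2
      + of_int y0 * quad_omega d + of_int y1 * (quad_omega d * \<alpha>) + of_int y2 * (quad_omega d * \<alpha>^2)"
    unfolding sextic_order_def by blast
  have "z = (of_int x0 + of_int y0 * quad_omega d) + (of_int x1 + of_int y1 * quad_omega d) * \<alpha>
      + (of_int x2 + of_int y2 * quad_omega d) * \<alpha>^2"
    unfolding z by (simp add: algebra_simps)
  then show "z \<in> quad_span (imag_quad_ints d) \<alpha>"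
    unfolding quad_span_def imag_quad_ints_eq[OF assms] by blast
next
  fix z assume "z \<in> quad_span (imag_quad_ints d) \<alpha>"
  then obtain x0 x1 x2 y0 y1 y2 where z: "z = (of_int x0 + of_int y0 * quad_omega d)
      + (of_int x1 + of_int y1 * quad_omega d) * \<alpha> + (of_int x2 + of_int y2 * quad_omega d) * \<alpha>^2"
    unfolding quad_span_def imag_quad_ints_eq[OF assms] by blast
  have "z = of_int x0 + of_int x1 * \<alpha> + of_int x2 * \<alpha>^2
      + of_int y0 * quad_omega d + of_int y1 * (quad_omega d * \<alpha>) + of_int y2 * (quad_omega d * \<alpha>^2)"
    unfolding z by (simp add: algebra_simps)
  then show "z \<in> sextic_order d \<alpha>" unfolding sextic_order_def by blast
qed

section \<open>Generators of relative power integral bases\<close>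

theorem proposition2:
  fixes d a :: int and \<alpha> :: complex
  assumes "d > 0" and "squarefree d"
    and "poly (simplest_cubic a) \<alpha> = 0"
  shows "\<forall>\<theta>. generates_rel_pib d \<alpha> \<theta> \<longleftrightarrow>
    (\<exists>Y1\<in>imag_quad_ints d. \<exists>Y2\<in>imag_quad_ints d. \<exists>X1 X2.
       X1 = Y1 - of_int a * Y2 \<and> X2 = Y2 \<and>
       (\<exists>\<epsilon>\<in>units_in (imag_quad_ints d).
          Y1^3 - of_int a * Y1^2 * Y2 - (of_int a + 3) * Y1 * Y2^2 - Y2^3 = \<epsilon>) \<and>
       rel_equivalent d \<alpha> \<theta> (X1 * \<alpha> + X2 * \<alpha>^2))"
proof
  fix \<theta>
  let ?R = "imag_quad_ints d"
  interpret cubic_order ?R \<alpha> "of_int a" "of_int a + 3" 1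
    using assms by (rule cubic_order_simplest_cubic)
  have O: "sextic_order d \<alpha> = ring_adjoin ?R \<alpha>"
    using sextic_order_eq_quad_span[OF assms(1,2)] ring_adjoin_eq_quad_span by simp
  have form: "cubic_form Y1 Y2 = Y1^3 - of_int a * Y1^2 * Y2 - (of_int a + 3) * Y1 * Y2^2 - Y2^3"
    for Y1 Y2 by (simp add: cubic_form_def)
  note O_closed = subring_set_closed[OF subring_set_ring_adjoin[OF R]]
    ring_adjoin_base[OF R] ring_adjoin_self[OF R]
  have one: "1 \<in> units_in ?R" unfolding units_in_def using closed(2) by force
  show "generates_rel_pib d \<alpha> \<theta> \<longleftrightarrow>
    (\<exists>Y1\<in>?R. \<exists>Y2\<in>?R. \<exists>X1 X2. X1 = Y1 - of_int a * Y2 \<and> X2 = Y2 \<and>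
       (\<exists>\<epsilon>\<in>units_in ?R. Y1^3 - of_int a * Y1^2 * Y2 - (of_int a + 3) * Y1 * Y2^2 - Y2^3 = \<epsilon>) \<and>
       rel_equivalent d \<alpha> \<theta> (X1 * \<alpha> + X2 * \<alpha>^2))" (is "_ \<longleftrightarrow> ?rhs")
  proof
    assume gen: "generates_rel_pib d \<alpha> \<theta>"
    then have \<theta>_in: "\<theta> \<in> sextic_order d \<alpha>" and \<theta>: "ring_adjoin ?R \<theta> = ring_adjoin ?R \<alpha>"
      using O unfolding generates_rel_pib_def by auto
    then obtain c x y where cxy: "c \<in> ?R" "x \<in> ?R" "y \<in> ?R" "\<theta> = c + x * \<alpha> + y * \<alpha>^2"
      unfolding O ring_adjoin_eq_quad_span quad_span_def by blast
    (* Dropping the constant term of \<theta> is already an equivalence, with unit 1. *)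
    have eq: "\<theta> = c + 1 * (x * \<alpha> + y * \<alpha>^2)" by (simp add: cxy algebra_simps)
    have "ring_adjoin ?R (x * \<alpha> + y * \<alpha>^2) = ring_adjoin ?R \<alpha>"
      using ring_adjoin_affine[OF R cxy(1) one, of "x * \<alpha> + y * \<alpha>^2"] \<theta> unfolding eq by simp
    then have unit: "cubic_form (x + of_int a * y) y \<in> units_in ?R"
      by (simp only: generates_iff_index_unit[OF cxy(2,3)])
    have "x * \<alpha> + y * \<alpha>^2 \<in> sextic_order d \<alpha>"
      unfolding O by (intro O_closed cxy)
    with \<theta>_in cxy(1) one eq have equiv: "rel_equivalent d \<alpha> \<theta> (x * \<alpha> + y * \<alpha>^2)"
      unfolding rel_equivalent_def by blast
    have "x + of_int a * y \<in> ?R" by (intro closed coeffs cxy)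
    moreover have "x = (x + of_int a * y) - of_int a * y" by simp
    ultimately show ?rhs using cxy(3) unit equiv unfolding form by metis
  next
    assume ?rhs
    then obtain Y1 Y2 where Y: "Y1 \<in> ?R" "Y2 \<in> ?R" and unit: "cubic_form Y1 Y2 \<in> units_in ?R"
      and equiv: "rel_equivalent d \<alpha> \<theta> ((Y1 - of_int a * Y2) * \<alpha> + Y2 * \<alpha>^2)"
      unfolding form by blast
    have "Y1 - of_int a * Y2 \<in> ?R" by (intro closed coeffs Y)
    from generates_iff_index_unit[OF this Y(2)] unit
    have gen: "ring_adjoin ?R ((Y1 - of_int a * Y2) * \<alpha> + Y2 * \<alpha>^2) = ring_adjoin ?R \<alpha>" by simp
    obtain b \<eta> where "b \<in> ?R" "\<eta> \<in> units_in ?R" "\<theta> \<in> sextic_order d \<alpha>"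
      "\<theta> = b + \<eta> * ((Y1 - of_int a * Y2) * \<alpha> + Y2 * \<alpha>^2)"
      using equiv unfolding rel_equivalent_def by blast
    with ring_adjoin_affine[OF R] gen show "generates_rel_pib d \<alpha> \<theta>"
      by (simp add: generates_rel_pib_def O)
  qed
qed

end
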